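(* Let $\mathcal{H}$ be a real Hilbert space, let $D$ be a nonempty closed convex subset of $\mathcal{H}$, let $m\geq 2$ be an integer, let $I=\{1,\ldots,m\}$, and let $(T_i)_{i\in I}$ be a family of nonexpansive operators from $D$ to $D$. Set $T=\frac1m\sum_{i\in I}T_i$ and, for every $\varepsilon\in\,]0,1[$, $$R^{\varepsilon}=\big(\operatorname{Id}+\varepsilon(T_m-\operatorname{Id})\big)\circ\cdots\circ\big(\operatorname{Id}+\varepsilon(T_1-\operatorname{Id})\big).$$ Suppose that there exist $\eta\in\,]0,1]$ and $\beta\in\,]0,+\infty[$ such that for every $\varepsilon\in\,]0,\eta[$ there exists $z^{\varepsilon}\in\operatorname{Fix}R^{\varepsilon}$ with $\|z^{\varepsilon}\|\leq\beta$, and that $$(\forall z\in\operatorname{Fix}T)\quad\lim_{\varepsilon\to0}d_{\operatorname{Fix}R^{\varepsilon}}(z)=0.$$ In addition, let $y_0\in D$, and suppose that the solution $x$ of the Cauchy problem $$x'(t)=-(\operatorname{Id}-T)x(t)\ \text{ on }\ ]0,+\infty[,\qquad x(0)=y_0,$$ converges strongly, say $x(t)\to\overline{x}\in D$ as $t\to+\infty$. For every $\varepsilon\in\,]0,\eta[$, let $(y_n^{\varepsilon})_{n\in\mathbb{N}}$ be defined by $y_0^{\varepsilon}=y_0$ and $$(\forall k\in\mathbb{N})(\forall i\in I)\quad y_{km+i}^{\varepsilon}=\big(\operatorname{Id}+\varepsilon(T_i-\operatorname{Id})\big)y_{km+i-1}^{\varepsilon},$$ and, for every $i\in I$, let $x_i^{\varepsilon}$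 be the weak limit of $(y_{km+i}^{\varepsilon})_{k\in\mathbb{N}}$ as $k\to+\infty$. Then $\overline{x}\in\operatorname{Fix}T$ and, for every $i\in I$, $x_i^{\varepsilon}\to\overline{x}$ (strongly) as $\varepsilon\to0$.
   Context: Nonexpansive means $1$-Lipschitz for the norm of $\mathcal{H}$. $\operatorname{Id}$ is the identity operator, $\operatorname{Fix}$ denotes the set of fixed points, and $d_C$ denotes the distance function to a nonempty closed convex set $C$. Known facts making the objects well defined: the Cauchy problem has a unique solution (continuous on $[0,+\infty[$, continuously differentiable on $]0,+\infty[$, with values in $D$), since $\operatorname{Id}-T$ is Lipschitz; and for every $\varepsilon\in\,]0,\eta[$, since $\operatorname{Fix}R^{\varepsilon}\neq\varnothing$, the weak limits $x_i^{\varepsilon}$ exist and satisfy the cycle equations $x_1^{\varepsilon}=(\operatorname{Id}+\varepsilon(T_1-\operatorname{Id}))x_m^{\varepsilon}$ and $x_i^{\varepsilon}=(\operatorname{Id}+\varepsilon(T_i-\operatorname{Id}))x_{i-1}^{\varepsilon}$ for $2\leq i\leq m$. *)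

theory Defs
  imports "HOL-Analysis.Analysis"
begin

definition Fix_on :: "'a set \<Rightarrow> ('a \<Rightarrow> 'a) \<Rightarrow> 'a set" where
  "Fix_on D F = {z \<in> D. F z = z}"

definition nonexpansive_self :: "'a::metric_space set \<Rightarrow> ('a \<Rightarrow> 'a) \<Rightarrow> bool" where
  "nonexpansive_self D F \<longleftrightarrow> F \<in> D \<rightarrow> D \<and> 1-lipschitz_on D F"

definition average :: "nat \<Rightarrow> (nat \<Rightarrow> 'a \<Rightarrow> 'a) \<Rightarrow> 'a \<Rightarrow> 'a::real_vector" where
  "average m T z = (1 / real m) *\<^sub>R (\<Sum>i=1..m. T i z)"

definition relax :: "real \<Rightarrow> ('a \<Rightarrow> 'a) \<Rightarrow> 'a \<Rightarrow> 'a::real_vector" where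
  "relax \<epsilon> F z = z + \<epsilon> *\<^sub>R (F z - z)"

text \<open>
  The operator \<open>relax_comp \<epsilon> T m\<close> is \<open>relax \<epsilon> (T m) \<circ> \<dots> \<circ> relax \<epsilon> (T 1)\<close>; the
  value of \<open>T\<close> at index 0 is never used.
\<close>
primrec relax_comp :: "real \<Rightarrow> (nat \<Rightarrow> 'a \<Rightarrow> 'a) \<Rightarrow> nat \<Rightarrow> 'a \<Rightarrow> 'a::real_vector" where
  "relax_comp \<epsilon> T 0 = id"
| "relax_comp \<epsilon> T (Suc n) = relax \<epsilon> (T (Suc n)) \<circ> relax_comp \<epsilon> T n"

text \<open>
  Weak convergence in a real Hilbert space, where the weak topology is the coarsest one
  making all functionals \<open>\<lambda>v. v \<bullet> u\<close> continuous.
\<close>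
definition weakly_converges :: "(nat \<Rightarrow> 'a::real_inner) \<Rightarrow> 'a \<Rightarrow> bool" where
  "weakly_converges s l \<longleftrightarrow> (\<forall>u. (\<lambda>n. s n \<bullet> u) \<longlonglongrightarrow> l \<bullet> u)"

text \<open>
  Solutions of \<open>x' = - (Id - F) x\<close> on the open half-line with \<open>x 0 = y0\<close>; the values of \<open>x\<close>
  at negative times are irrelevant. For nonexpansive \<open>F\<close> the derivative is automatically
  continuous, so continuous differentiability is not a separate clause.
\<close>
definition Cauchy_solution ::
    "'a set \<Rightarrow> ('a \<Rightarrow> 'a) \<Rightarrow> 'a \<Rightarrow> (real \<Rightarrow> 'a::real_normed_vector) \<Rightarrow> bool" where
  "Cauchy_solution D F y0 x \<longleftrightarrow>
     continuous_on {0..} x \<and> (\<forall>t\<ge>0. x t \<in> D) \<and> x 0 = y0 \<and>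
     (\<forall>t>0. (x has_vector_derivative - (x t - F (x t))) (at t))"

end

theory Submission
  imports Defs
begin

text \<open>
  Write \<open>R\<close> for \<open>relax_comp \<epsilon> T m\<close>, \<open>A\<close> for \<open>average m T\<close>, and \<open>h = m \<epsilon>\<close>. One sweep of the
  relaxed operators is, up to an error of order \<open>h\<^sup>2\<close>, the explicit Euler step
  \<open>u \<mapsto> u + h (A u - u)\<close> for \<open>x' = A x - x\<close>
  (\<open>norm_relax_comp_minus_euler_step_le\<close>), and the flow itself agrees with an Euler step up to the
  same order (\<open>norm_flow_minus_euler_step_le\<close>). As \<open>R\<close> is nonexpansive, local errors are not
  amplified: they add up, and the sweeps follow the trajectory \<open>x\<close> up to an error of order \<open>h\<close> on
  every bounded time interval (\<open>norm_sweeps_minus_flow_le\<close>).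

  Now pick a time \<open>t\<close> after which \<open>x\<close> stays near its limit \<open>xbar\<close>. For small \<open>\<epsilon>\<close> the sweeps are
  near \<open>xbar\<close> at about time \<open>t\<close>. The limit of a trajectory is an equilibrium
  (\<open>limit_of_flow_fixed\<close>), so \<open>xbar\<close> is fixed by \<open>A\<close>, and the hypothesis on distances supplies a
  fixed point of \<open>R\<close> near \<open>xbar\<close>. Nonexpansiveness means that the sweeps never move away from
  that fixed point, so they remain near \<open>xbar\<close> for ever. Closed balls are weakly closed
  (\<open>norm_weak_limit_minus_le\<close>), hence the weak limits are near \<open>xbar\<close> in norm. The partial sweeps
  that lead to the other phases of the cycle are nonexpansive and displace \<open>xbar\<close> by \<open>O(\<epsilon>)\<close> only,
  so they do not spoil the estimate.
\<close>

section \<open>Relaxations and averages of nonexpansive operators\<close>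

lemma nonexpansive_self_iff_norm:
  fixes F :: "'a::real_normed_vector \<Rightarrow> 'a"
  shows "nonexpansive_self D F \<longleftrightarrow>
    (\<forall>u\<in>D. F u \<in> D) \<and> (\<forall>u\<in>D. \<forall>v\<in>D. norm (F u - F v) \<le> norm (u - v))"
  by (auto simp: nonexpansive_self_def lipschitz_on_def dist_norm)

lemma nonexpansive_self_in:
  "nonexpansive_self D F \<Longrightarrow> u \<in> D \<Longrightarrow> F u \<in> D"
  by (auto simp: nonexpansive_self_def)

lemma nonexpansive_self_norm_le:
  fixes F :: "'a::real_normed_vector \<Rightarrow> 'a"
  shows "nonexpansive_self D F \<Longrightarrow> u \<in> D \<Longrightarrow> v \<in> D \<Longrightarrow> norm (F u - F v) \<le> norm (u - v)"
  by (simp add: nonexpansive_self_iff_norm)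

lemma norm_displacement_diff_le:
  fixes F :: "'a::real_normed_vector \<Rightarrow> 'a"
  assumes "nonexpansive_self D F" "u \<in> D" "v \<in> D"
  shows "norm ((F u - u) - (F v - v)) \<le> 2 * norm (u - v)"
proof -
  have "norm ((F u - u) - (F v - v)) = norm ((F u - F v) - (u - v))"
    by (simp add: algebra_simps)
  also have "\<dots> \<le> norm (F u - F v) + norm (u - v)"
    by (rule norm_triangle_ineq4)
  finally show ?thesis
    using nonexpansive_self_norm_le[OF assms] by simp
qed

lemma nonexpansive_self_relax:
  fixes F :: "'a::real_normed_vector \<Rightarrow> 'a"
  assumes "convex D" "nonexpansive_self D F" "0 \<le> \<epsilon>" "\<epsilon> \<le> 1"
  shows "nonexpansive_self D (relax \<epsilon> F)"
proof -
  have eq: "relax \<epsilon> F u = (1 - \<epsilon>) *\<^sub>R u + \<epsilon> *\<^sub>R F u" for u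
    by (simp add: relax_def algebra_simps)
  have "norm (relax \<epsilon> F u - relax \<epsilon> F v) \<le> norm (u - v)" if "u \<in> D" "v \<in> D" for u v
  proof -
    have "relax \<epsilon> F u - relax \<epsilon> F v = (1 - \<epsilon>) *\<^sub>R (u - v) + \<epsilon> *\<^sub>R (F u - F v)"
      by (simp add: eq algebra_simps)
    then have "norm (relax \<epsilon> F u - relax \<epsilon> F v) \<le> (1 - \<epsilon>) * norm (u - v) + \<epsilon> * norm (F u - F v)"
      using norm_triangle_ineq[of "(1 - \<epsilon>) *\<^sub>R (u - v)" "\<epsilon> *\<^sub>R (F u - F v)"] assms by simp
    also have "\<dots> \<le> (1 - \<epsilon>) * norm (u - v) + \<epsilon> * norm (u - v)"
      using nonexpansive_self_norm_le[OF assms(2) that] assms(3)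
      by (intro add_left_mono mult_left_mono)
    finally show ?thesis by (simp add: algebra_simps)
  qed
  moreover have "relax \<epsilon> F u \<in> D" if "u \<in> D" for u
    unfolding eq using assms that by (intro convexD) (auto intro: nonexpansive_self_in)
  ultimately show ?thesis
    by (simp add: nonexpansive_self_iff_norm)
qed

lemma nonexpansive_self_relax_comp:
  fixes T :: "nat \<Rightarrow> 'a::real_normed_vector \<Rightarrow> 'a"
  assumes "convex D" "0 \<le> \<epsilon>" "\<epsilon> \<le> 1"
    and "\<And>i. i \<in> {1..n} \<Longrightarrow> nonexpansive_self D (T i)"
  shows "nonexpansive_self D (relax_comp \<epsilon> T n)"
  using assms(4)
proof (induction n)
  case 0
  then show ?case by (simp add: nonexpansive_self_iff_norm)
next
  case (Suc n)
  have "nonexpansive_self D (relax_comp \<epsilon> T n)"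
    by (rule Suc.IH) (use Suc.prems in auto)
  moreover have "nonexpansive_self D (relax \<epsilon> (T (Suc n)))"
    by (intro nonexpansive_self_relax assms Suc.prems) auto
  ultimately show ?case
    unfolding nonexpansive_self_iff_norm relax_comp.simps comp_apply by (meson order_trans)
qed

lemma nonexpansive_self_average:
  fixes T :: "nat \<Rightarrow> 'a::real_normed_vector \<Rightarrow> 'a"
  assumes "convex D" "m \<ge> 1"
    and T: "\<And>i. i \<in> {1..m} \<Longrightarrow> nonexpansive_self D (T i)"
  shows "nonexpansive_self D (average m T)"
proof -
  have "average m T u \<in> D" if "u \<in> D" for u
  proof -
    have "(\<Sum>i=1..m. (1 / real m) *\<^sub>R T i u) \<in> D"
      by (rule convex_sum) (use assms that in \<open>auto intro: nonexpansive_self_in\<close>)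
    then show ?thesis by (simp add: average_def scaleR_sum_right)
  qed
  moreover have "norm (average m T u - average m T v) \<le> norm (u - v)" if "u \<in> D" "v \<in> D" for u v
  proof -
    have "norm (\<Sum>i=1..m. T i u - T i v) \<le> (\<Sum>i=1..m. norm (u - v))"
      by (rule sum_norm_le) (use T that in \<open>auto intro: nonexpansive_self_norm_le\<close>)
    moreover have "average m T u - average m T v = (1 / real m) *\<^sub>R (\<Sum>i=1..m. T i u - T i v)"
      by (simp add: average_def sum_subtractf scaleR_diff_right)
    ultimately show ?thesis using \<open>m \<ge> 1\<close> by (simp add: field_simps)
  qed
  ultimately show ?thesis by (simp add: nonexpansive_self_iff_norm)
qed

lemma scaleR_average_displacement:
  assumes "m \<ge> 1"
  shows "real m *\<^sub>R (average m T u - u) = (\<Sum>i=1..m. T i u - u)"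
  using assms by (simp add: average_def sum_subtractf scaleR_diff_right sum_constant_scaleR)

lemma norm_average_displacement_le:
  fixes T :: "nat \<Rightarrow> 'a::real_normed_vector \<Rightarrow> 'a"
  assumes "m \<ge> 1" "\<And>i. i \<in> {1..m} \<Longrightarrow> norm (T i u - u) \<le> M"
  shows "norm (average m T u - u) \<le> M"
proof -
  have "real m * norm (average m T u - u) = norm (\<Sum>i=1..m. T i u - u)"
    unfolding scaleR_average_displacement[OF assms(1), symmetric] by simp
  also have "\<dots> \<le> (\<Sum>i=1..m. M)"
    by (rule sum_norm_le) (use assms(2) in auto)
  finally show ?thesis using assms(1) by simp
qed

section \<open>A sweep is almost an Euler step\<close>

lemma norm_relax_comp_displacement_le:
  fixes T :: "nat \<Rightarrow> 'a::real_normed_vector \<Rightarrow> 'a"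
  assumes "convex D" "0 \<le> \<epsilon>" "\<epsilon> \<le> 1" "u \<in> D"
    and "\<And>i. i \<in> {1..n} \<Longrightarrow> nonexpansive_self D (T i)"
    and "\<And>i. i \<in> {1..n} \<Longrightarrow> norm (T i u - u) \<le> M"
  shows "norm (relax_comp \<epsilon> T n u - u) \<le> real n * \<epsilon> * M"
  using assms(5,6)
proof (induction n)
  case 0
  then show ?case by simp
next
  case (Suc n)
  let ?a = "relax_comp \<epsilon> T n u" and ?S = "relax \<epsilon> (T (Suc n))"
  have "nonexpansive_self D (relax_comp \<epsilon> T n)"
    by (rule nonexpansive_self_relax_comp) (use assms Suc.prems in auto)
  then have "?a \<in> D"
    using \<open>u \<in> D\<close> by (rule nonexpansive_self_in)
  moreover have "nonexpansive_self D ?S"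
    by (rule nonexpansive_self_relax) (use assms Suc.prems in auto)
  ultimately have "norm (?S ?a - ?S u) \<le> norm (?a - u)"
    using \<open>u \<in> D\<close> by (auto intro: nonexpansive_self_norm_le)
  moreover have "norm (?a - u) \<le> real n * \<epsilon> * M"
    by (rule Suc.IH) (use Suc.prems in auto)
  moreover have "norm (?S u - u) \<le> \<epsilon> * M"
    using Suc.prems(2)[of "Suc n"] \<open>0 \<le> \<epsilon>\<close> by (simp add: relax_def mult_left_mono)
  ultimately show ?case
    using norm_triangle_ineq[of "?S ?a - ?S u" "?S u - u"] by (simp add: algebra_simps)
qed

text \<open>
  All displacements \<open>T i - Id\<close> are 2-Lipschitz, and by the preceding bound they are evaluated within
  \<open>n \<epsilon> M\<close> of \<open>u\<close>; replacing each of the \<open>n\<close> evaluation points by \<open>u\<close> thus costs at most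
  \<open>2 n \<epsilon>\<^sup>2 M\<close>, once the factor \<open>\<epsilon>\<close> of the displacements is taken into account.
\<close>

lemma norm_relax_comp_minus_first_order_le:
  fixes T :: "nat \<Rightarrow> 'a::real_normed_vector \<Rightarrow> 'a"
  assumes "convex D" "0 \<le> \<epsilon>" "\<epsilon> \<le> 1" "u \<in> D" "0 \<le> M"
    and "\<And>i. i \<in> {1..n} \<Longrightarrow> nonexpansive_self D (T i)"
    and "\<And>i. i \<in> {1..n} \<Longrightarrow> norm (T i u - u) \<le> M"
  shows "norm (relax_comp \<epsilon> T n u - (u + \<epsilon> *\<^sub>R (\<Sum>i=1..n. T i u - u))) \<le> 2 * M * (real n * \<epsilon>)\<^sup>2"
  using assms(6,7)
proof (induction n)
  case 0
  then show ?case by simp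
next
  case (Suc n)
  let ?a = "relax_comp \<epsilon> T n u" and ?F = "T (Suc n)"
  let ?g = "(?F ?a - ?a) - (?F u - u)"
  have "nonexpansive_self D (relax_comp \<epsilon> T n)"
    by (rule nonexpansive_self_relax_comp) (use assms Suc.prems in auto)
  then have "?a \<in> D"
    using \<open>u \<in> D\<close> by (rule nonexpansive_self_in)
  then have "norm ?g \<le> 2 * norm (?a - u)"
    by (rule norm_displacement_diff_le[rotated]) (use assms Suc.prems in auto)
  also have "norm (?a - u) \<le> real n * \<epsilon> * M"
    by (rule norm_relax_comp_displacement_le) (use assms Suc.prems in auto)
  finally have g: "norm (\<epsilon> *\<^sub>R ?g) \<le> \<epsilon> * (2 * (real n * \<epsilon> * M))"
    using \<open>0 \<le> \<epsilon>\<close> by (simp add: mult_left_mono)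
  have "norm (?a - (u + \<epsilon> *\<^sub>R (\<Sum>i=1..n. T i u - u))) \<le> 2 * M * (real n * \<epsilon>)\<^sup>2"
    by (rule Suc.IH) (use Suc.prems in auto)
  moreover have "relax_comp \<epsilon> T (Suc n) u - (u + \<epsilon> *\<^sub>R (\<Sum>i=1..Suc n. T i u - u))
      = (?a - (u + \<epsilon> *\<^sub>R (\<Sum>i=1..n. T i u - u))) + \<epsilon> *\<^sub>R ?g"
    by (simp add: relax_def algebra_simps)
  ultimately have "norm (relax_comp \<epsilon> T (Suc n) u - (u + \<epsilon> *\<^sub>R (\<Sum>i=1..Suc n. T i u - u)))
      \<le> 2 * M * (real n * \<epsilon>)\<^sup>2 + \<epsilon> * (2 * (real n * \<epsilon> * M))"
    using g norm_triangle_ineq by (smt (verit))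
  also have "\<dots> = 2 * M * \<epsilon>\<^sup>2 * ((real n)\<^sup>2 + real n)"
    by (simp add: power2_eq_square algebra_simps)
  also have "\<dots> \<le> 2 * M * \<epsilon>\<^sup>2 * (real (Suc n))\<^sup>2"
    using \<open>0 \<le> M\<close> by (intro mult_left_mono) (auto simp: power2_eq_square algebra_simps)
  finally show ?case by (simp add: power_mult_distrib mult_ac)
qed

lemma norm_relax_comp_minus_euler_step_le:
  fixes T :: "nat \<Rightarrow> 'a::real_normed_vector \<Rightarrow> 'a"
  assumes "convex D" "0 \<le> \<epsilon>" "\<epsilon> \<le> 1" "u \<in> D" "0 \<le> M" "m \<ge> 1"
    and "\<And>i. i \<in> {1..m} \<Longrightarrow> nonexpansive_self D (T i)"
    and "\<And>i. i \<in> {1..m} \<Longrightarrow> norm (T i u - u) \<le> M"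
  shows "norm (relax_comp \<epsilon> T m u - (u + (real m * \<epsilon>) *\<^sub>R (average m T u - u)))
    \<le> 2 * M * (real m * \<epsilon>)\<^sup>2"
proof -
  have "(real m * \<epsilon>) *\<^sub>R (average m T u - u) = \<epsilon> *\<^sub>R (\<Sum>i=1..m. T i u - u)"
    unfolding scaleR_average_displacement[OF \<open>m \<ge> 1\<close>, symmetric] by (simp add: mult.commute)
  then show ?thesis
    using norm_relax_comp_minus_first_order_le[of D \<epsilon> u M m T] assms by simp
qed

section \<open>The flow is almost an Euler step\<close>

text \<open>
  The mean value inequality for \<open>\<lambda>r. x r - r *\<^sub>R v\<close>: a trajectory whose velocity stays near \<open>v\<close> is
  nearly a uniform motion. With \<open>v = 0\<close> it is a Lipschitz bound.
\<close>

lemma Cauchy_solution_mean_value: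
  fixes x :: "real \<Rightarrow> 'a::real_inner"
  assumes "Cauchy_solution D F y0 x" "0 \<le> s" "s < t"
    and "\<And>r. s < r \<Longrightarrow> r < t \<Longrightarrow> norm ((F (x r) - x r) - v) \<le> B"
  shows "norm (x t - x s - (t - s) *\<^sub>R v) \<le> (t - s) * B"
proof -
  let ?f = "\<lambda>r. x r - r *\<^sub>R v"
  have cont: "continuous_on {s..t} ?f"
    using assms(1,2) unfolding Cauchy_solution_def
    by (intro continuous_intros) (auto elim: continuous_on_subset)
  have deriv: "(?f has_derivative (\<lambda>d. d *\<^sub>R ((F (x r) - x r) - v))) (at r)"
    if "s < r" "r < t" for r
  proof -
    have "(x has_vector_derivative F (x r) - x r) (at r)"
      using assms(1,2) that unfolding Cauchy_solution_def by auto
    then have "(?f has_vector_derivative (F (x r) - x r) - 1 *\<^sub>R v) (at r)"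
      by (auto intro!: derivative_eq_intros)
    then show ?thesis by (simp add: has_vector_derivative_def)
  qed
  obtain r where r: "r \<in> {s<..<t}"
    and "norm (?f t - ?f s) \<le> norm ((t - s) *\<^sub>R ((F (x r) - x r) - v))"
    using mvt_general[OF \<open>s < t\<close> cont deriv] by blast
  then have "norm (?f t - ?f s) \<le> (t - s) * norm ((F (x r) - x r) - v)"
    using \<open>s < t\<close> by simp
  also have "\<dots> \<le> (t - s) * B"
    using assms(3,4) r by (intro mult_left_mono) auto
  finally show ?thesis by (simp add: algebra_simps)
qed

text \<open>
  The speed is bounded by \<open>M\<close>, so during a time \<open>h\<close> the trajectory moves by at most \<open>M h\<close>, and its
  velocity, a 2-Lipschitz function of the position, changes by at most \<open>2 M h\<close>.
\<close>

lemma norm_flow_minus_euler_step_le: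
  fixes x :: "real \<Rightarrow> 'a::real_inner"
  assumes sol: "Cauchy_solution D F y0 x" and F: "nonexpansive_self D F"
    and M: "\<And>r. 0 \<le> r \<Longrightarrow> norm (F (x r) - x r) \<le> M"
    and "0 \<le> s" "0 < h"
  shows "norm (x (s + h) - (x s + h *\<^sub>R (F (x s) - x s))) \<le> 2 * M * h\<^sup>2"
proof -
  have "0 \<le> M" using M[of 0] norm_ge_zero order_trans by blast
  have "norm ((F (x r) - x r) - (F (x s) - x s)) \<le> 2 * (h * M)" if r: "s < r" "r < s + h" for r
  proof -
    have "norm (x r - x s - (r - s) *\<^sub>R 0) \<le> (r - s) * M"
      by (rule Cauchy_solution_mean_value[OF sol]) (use M r \<open>0 \<le> s\<close> in auto)
    also have "\<dots> \<le> h * M"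
      using r \<open>0 \<le> M\<close> by (intro mult_right_mono) auto
    finally have "norm (x r - x s) \<le> h * M" by simp
    moreover have "x r \<in> D" "x s \<in> D"
      using sol r \<open>0 \<le> s\<close> by (auto simp: Cauchy_solution_def)
    ultimately show ?thesis
      using norm_displacement_diff_le[OF F, of "x r" "x s"] by linarith
  qed
  then have "norm (x (s + h) - x s - (s + h - s) *\<^sub>R (F (x s) - x s)) \<le> (s + h - s) * (2 * (h * M))"
    by (intro Cauchy_solution_mean_value[OF sol]) (use assms in auto)
  then show ?thesis by (simp add: power2_eq_square algebra_simps)
qed

text \<open>
  On a time interval of length one, far out, the displacement of the trajectory is both close to
  zero, because the trajectory converges, and close to its velocity, which is nearly
  \<open>F xbar - xbar\<close>.
\<close>

lemma limit_of_flow_fixed: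
  fixes x :: "real \<Rightarrow> 'a::real_inner"
  assumes sol: "Cauchy_solution D F y0 x" and F: "nonexpansive_self D F"
    and "xbar \<in> D" and lim: "(x \<longlongrightarrow> xbar) at_top"
  shows "F xbar = xbar"
proof (rule ccontr)
  assume "F xbar \<noteq> xbar"
  define v where "v = F xbar - xbar"
  have "norm v / 5 > 0"
    using \<open>F xbar \<noteq> xbar\<close> by (simp add: v_def)
  then have "eventually (\<lambda>r. dist (x r) xbar < norm v / 5) at_top"
    using lim tendstoD by blast
  then obtain S where S: "\<And>r. r \<ge> S \<Longrightarrow> norm (x r - xbar) < norm v / 5"
    by (auto simp: eventually_at_top_linorder dist_norm)
  define s where "s = max S 0"
  have "norm ((F (x r) - x r) - v) \<le> 2 * (norm v / 5)" if "s < r" for r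
  proof -
    have "x r \<in> D" using sol that by (auto simp: Cauchy_solution_def s_def)
    then have "norm ((F (x r) - x r) - v) \<le> 2 * norm (x r - xbar)"
      unfolding v_def using F \<open>xbar \<in> D\<close> by (intro norm_displacement_diff_le)
    then show ?thesis using S[of r] that by (simp add: s_def)
  qed
  then have "norm (x (s + 1) - x s - (s + 1 - s) *\<^sub>R v) \<le> (s + 1 - s) * (2 * (norm v / 5))"
    by (intro Cauchy_solution_mean_value[OF sol]) (auto simp: s_def)
  then have 1: "norm (x (s + 1) - x s - v) \<le> 2 * (norm v / 5)"
    by simp
  have 2: "norm (x (s + 1) - xbar) < norm v / 5" "norm (x s - xbar) < norm v / 5"
    by (rule S; simp add: s_def)+
  have "norm v = norm ((x (s + 1) - xbar) - (x s - xbar) - (x (s + 1) - x s - v))"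
    by (simp add: algebra_simps)
  also have "\<dots> \<le> norm (x (s + 1) - xbar) + norm (x s - xbar) + norm (x (s + 1) - x s - v)"
    using norm_triangle_ineq4 by (smt (verit))
  also have "\<dots> < norm v / 5 + norm v / 5 + 2 * (norm v / 5)"
    using 1 2 by linarith
  finally show False
    using norm_ge_zero[of v] by linarith
qed

lemma convergent_flow_bounded:
  fixes x :: "real \<Rightarrow> 'a::real_normed_vector"
  assumes "continuous_on {0..} x" "(x \<longlongrightarrow> xbar) at_top"
  obtains C where "0 \<le> C" "\<And>s. 0 \<le> s \<Longrightarrow> norm (x s - xbar) \<le> C"
proof -
  have "eventually (\<lambda>r. dist (x r) xbar < 1) at_top"
    using assms(2) by (rule tendstoD) simp
  then obtain S where S: "\<And>r. r \<ge> S \<Longrightarrow> norm (x r - xbar) < 1"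
    by (auto simp: eventually_at_top_linorder dist_norm)
  have "compact ((\<lambda>s. x s - xbar) ` {0..S})"
    using assms(1) by (intro compact_continuous_image continuous_intros)
      (auto elim: continuous_on_subset)
  then obtain B where B: "\<And>s. s \<in> {0..S} \<Longrightarrow> norm (x s - xbar) \<le> B"
    using compact_imp_bounded bounded_iff by (metis imageI)
  show ?thesis
  proof (rule that[of "max 1 B"])
    show "norm (x s - xbar) \<le> max 1 B" if "0 \<le> s" for s
      using B[of s] S[of s] that by (cases "s \<le> S") auto
  qed simp
qed

section \<open>Sweeps follow the flow\<close>

text \<open>
  Each sweep adds the local errors of the two Euler approximations, \<open>2 M h\<^sup>2\<close> each, to an error that
  nonexpansiveness prevents from growing; after \<open>k\<close> sweeps the sum is \<open>4 M h\<close> times the elapsed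
  time \<open>k h\<close>.
\<close>

lemma norm_sweeps_minus_flow_le:
  fixes T :: "nat \<Rightarrow> 'a::real_inner \<Rightarrow> 'a"
  assumes "convex D" "0 < \<epsilon>" "\<epsilon> \<le> 1" "m \<ge> 1" "0 \<le> M"
    and T: "\<And>i. i \<in> {1..m} \<Longrightarrow> nonexpansive_self D (T i)"
    and sol: "Cauchy_solution D (average m T) y0 x"
    and M: "\<And>i s. i \<in> {1..m} \<Longrightarrow> 0 \<le> s \<Longrightarrow> norm (T i (x s) - x s) \<le> M"
  shows "norm ((relax_comp \<epsilon> T m ^^ k) y0 - x (real k * (real m * \<epsilon>)))
    \<le> 4 * M * (real m * \<epsilon>) * (real k * (real m * \<epsilon>))"
proof (induction k)
  case 0
  then show ?case using sol by (simp add: Cauchy_solution_def)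
next
  case (Suc k)
  define h where "h = real m * \<epsilon>"
  define u where "u = x (real k * h)"
  define w where "w = (relax_comp \<epsilon> T m ^^ k) y0"
  let ?R = "relax_comp \<epsilon> T m" and ?e = "u + h *\<^sub>R (average m T u - u)"
  have h: "0 < h" "0 \<le> real k * h" using assms by (auto simp: h_def)
  have R: "nonexpansive_self D ?R"
    by (rule nonexpansive_self_relax_comp) (use assms in auto)
  have "u \<in> D" "y0 \<in> D"
    using sol h by (auto simp: Cauchy_solution_def u_def)
  have "(?R ^^ j) y0 \<in> D" for j
    by (induction j) (use R \<open>y0 \<in> D\<close> in \<open>auto intro: nonexpansive_self_in\<close>)
  then have "norm (?R w - ?R u) \<le> norm (w - u)"
    using R \<open>u \<in> D\<close> by (auto intro: nonexpansive_self_norm_le simp: w_def)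
  also have "\<dots> \<le> 4 * M * h * (real k * h)"
    using Suc.IH by (simp add: w_def u_def h_def)
  finally have 1: "norm (?R w - ?R u) \<le> 4 * M * h * (real k * h)" .
  have 2: "norm (?R u - ?e) \<le> 2 * M * h\<^sup>2"
    unfolding h_def
    by (rule norm_relax_comp_minus_euler_step_le)
      (use assms \<open>u \<in> D\<close> h in \<open>auto simp: u_def\<close>)
  have 3: "norm (x (real k * h + h) - ?e) \<le> 2 * M * h\<^sup>2"
    unfolding u_def
    by (rule norm_flow_minus_euler_step_le[OF sol])
      (use assms h in \<open>auto intro!: nonexpansive_self_average norm_average_displacement_le\<close>)
  have "?R w - x (real k * h + h) = (?R w - ?R u) + (?R u - ?e) - (x (real k * h + h) - ?e)"
    by simp
  then have "norm (?R w - x (real k * h + h)) \<le> 4 * M * h * (real k * h) + 2 * M * h\<^sup>2 + 2 * M * h\<^sup>2"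
    using 1 2 3 norm_triangle_ineq norm_triangle_ineq4 by (smt (verit))
  then have "norm (?R w - x (real (Suc k) * h)) \<le> 4 * M * h * (real (Suc k) * h)"
    by (simp add: power2_eq_square algebra_simps)
  then show ?case by (simp add: w_def h_def)
qed

section \<open>Asymptotics of the cycles\<close>

lemma norm_iterate_minus_fixed_point_antimono:
  fixes F :: "'a::real_normed_vector \<Rightarrow> 'a"
  assumes "nonexpansive_self D F" "y \<in> D" "z \<in> Fix_on D F" "k \<le> j"
  shows "norm ((F ^^ j) y - z) \<le> norm ((F ^^ k) y - z)"
  using \<open>k \<le> j\<close>
proof (induction j rule: dec_induct)
  case (step j)
  have "(F ^^ j) y \<in> D" for j
    by (induction j) (use assms in \<open>auto intro: nonexpansive_self_in\<close>)
  then have "norm (F ((F ^^ j) y) - F z) \<le> norm ((F ^^ j) y - z)"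
    using assms by (intro nonexpansive_self_norm_le) (auto simp: Fix_on_def)
  then show ?case using step assms(3) by (simp add: Fix_on_def)
qed simp

text \<open>
  Testing weak convergence against \<open>u = l - c\<close> itself and applying the Cauchy-Schwarz inequality gives
  \<open>(norm (l - c))\<^sup>2 \<le> B * norm (l - c)\<close>.
\<close>

lemma norm_weak_limit_minus_le:
  fixes s :: "nat \<Rightarrow> 'a::real_inner"
  assumes "weakly_converges s l" "eventually (\<lambda>n. norm (s n - c) \<le> B) sequentially"
  shows "norm (l - c) \<le> B"
proof -
  have "(\<lambda>n. s n \<bullet> (l - c) - c \<bullet> (l - c)) \<longlonglongrightarrow> l \<bullet> (l - c) - c \<bullet> (l - c)"
    using assms(1) by (intro tendsto_diff tendsto_const) (simp add: weakly_converges_def)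
  moreover have "eventually (\<lambda>n. s n \<bullet> (l - c) - c \<bullet> (l - c) \<le> B * norm (l - c)) sequentially"
    using assms(2)
  proof eventually_elim
    case (elim n)
    have "(s n - c) \<bullet> (l - c) \<le> norm (s n - c) * norm (l - c)"
      by (rule norm_cauchy_schwarz)
    also have "\<dots> \<le> B * norm (l - c)"
      using elim by (intro mult_right_mono) auto
    finally show ?case by (simp add: inner_diff_left)
  qed
  ultimately have "l \<bullet> (l - c) - c \<bullet> (l - c) \<le> B * norm (l - c)"
    by (intro tendsto_upperbound) auto
  then have "norm (l - c) * norm (l - c) \<le> B * norm (l - c)"
    by (simp flip: inner_diff_left add: dot_square_norm power2_eq_square)
  moreover have "0 \<le> B"
    using assms(2) eventually_happens'[OF sequentially_bot] norm_ge_zero order_trans by blast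
  ultimately show ?thesis
    by (cases "norm (l - c) = 0") (auto simp: mult_le_cancel_right)
qed

lemma cyclic_iteration_eq_sweeps:
  assumes init: "y 0 = y0"
    and step: "\<And>k i. i \<in> {1..m} \<Longrightarrow> y (k * m + i) = relax \<epsilon> (T i) (y (k * m + i - 1))"
    and "i \<le> m"
  shows "y (k * m + i) = relax_comp \<epsilon> T i ((relax_comp \<epsilon> T m ^^ k) y0)"
proof -
  have phase: "y (k * m + i) = relax_comp \<epsilon> T i (y (k * m))" if "i \<le> m" for k i
    using that
  proof (induction i)
    case (Suc i)
    then show ?case using step[of "Suc i" k] by simp
  qed simp
  have "y (k * m) = (relax_comp \<epsilon> T m ^^ k) y0" for k
  proof (induction k)
    case (Suc k)
    then show ?case using phase[of m k] by (simp add: add.commute)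
  qed (simp add: init)
  then show ?thesis using phase[OF \<open>i \<le> m\<close>] by simp
qed

theorem theorem3p4:
  fixes D :: "'a::{real_inner, complete_space} set"
    and m :: nat
    and T :: "nat \<Rightarrow> 'a \<Rightarrow> 'a"
    and \<eta> \<beta> :: real
    and y0 xbar :: 'a
    and x :: "real \<Rightarrow> 'a"
    and y xw :: "real \<Rightarrow> nat \<Rightarrow> 'a"
  assumes D: "D \<noteq> {}" "closed D" "convex D"
    and m: "m \<ge> 2"
    and T: "\<And>i. i \<in> {1..m} \<Longrightarrow> nonexpansive_self D (T i)"
    and \<eta>: "0 < \<eta>" "\<eta> \<le> 1"
    and \<beta>: "0 < \<beta>"
    and bounded_fix: "\<And>\<epsilon>. \<epsilon> \<in> {0<..<\<eta>} \<Longrightarrow>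
          \<exists>z \<in> Fix_on D (relax_comp \<epsilon> T m). norm z \<le> \<beta>"
    and dist_fix: "\<And>z. z \<in> Fix_on D (average m T) \<Longrightarrow>
          ((\<lambda>\<epsilon>. infdist z (Fix_on D (relax_comp \<epsilon> T m))) \<longlongrightarrow> 0) (at_right 0)"
    and y0: "y0 \<in> D"
    and x: "Cauchy_solution D (average m T) y0 x"
    and xbar: "xbar \<in> D" "(x \<longlongrightarrow> xbar) at_top"
    and y_init: "\<And>\<epsilon>. \<epsilon> \<in> {0<..<\<eta>} \<Longrightarrow> y \<epsilon> 0 = y0"
    and y_step: "\<And>\<epsilon> k i. \<epsilon> \<in> {0<..<\<eta>} \<Longrightarrow> i \<in> {1..m} \<Longrightarrow>
          y \<epsilon> (k * m + i) = relax \<epsilon> (T i) (y \<epsilon> (k * m + i - 1))"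
    and xw: "\<And>\<epsilon> i. \<epsilon> \<in> {0<..<\<eta>} \<Longrightarrow> i \<in> {1..m} \<Longrightarrow>
          weakly_converges (\<lambda>k. y \<epsilon> (k * m + i)) (xw \<epsilon> i)"
  shows "xbar \<in> Fix_on D (average m T) \<and>
         (\<forall>i \<in> {1..m}. ((\<lambda>\<epsilon>. xw \<epsilon> i) \<longlongrightarrow> xbar) (at_right 0))"
proof (intro conjI ballI)
  have "m \<ge> 1" using m by simp
  have "nonexpansive_self D (average m T)"
    using D(3) \<open>m \<ge> 1\<close> T by (rule nonexpansive_self_average)
  then show fixed: "xbar \<in> Fix_on D (average m T)"
    using limit_of_flow_fixed[OF x] xbar by (simp add: Fix_on_def)

  obtain C where C: "0 \<le> C" "\<And>s. 0 \<le> s \<Longrightarrow> norm (x s - xbar) \<le> C"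
    using x xbar(2) convergent_flow_bounded unfolding Cauchy_solution_def by metis
  \<comment> \<open>\<open>M\<close> bounds the displacements of all \<open>T i\<close> at \<open>xbar\<close> and, by \<open>norm_displacement_diff_le\<close>, also
      along the trajectory.\<close>
  define M where "M = (\<Sum>i=1..m. norm (T i xbar - xbar)) + 2 * C"
  have "0 \<le> M" using C(1) by (simp add: M_def sum_nonneg)
  have disp_xbar: "norm (T i xbar - xbar) \<le> M - 2 * C" if "i \<in> {1..m}" for i
    using that by (auto simp: M_def intro!: member_le_sum)
  have disp_x: "norm (T i (x s) - x s) \<le> M" if "i \<in> {1..m}" "0 \<le> s" for i s
  proof -
    have "x s \<in> D" using x that by (simp add: Cauchy_solution_def)
    then have "norm ((T i (x s) - x s) - (T i xbar - xbar)) \<le> 2 * norm (x s - xbar)"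
      using T that xbar by (intro norm_displacement_diff_le) auto
    then show ?thesis
      using C(2)[OF that(2)] disp_xbar[OF that(1)] norm_triangle_sub[of "T i (x s) - x s" "T i xbar - xbar"]
      by linarith
  qed

  fix i assume i: "i \<in> {1..m}"
  show "((\<lambda>\<epsilon>. xw \<epsilon> i) \<longlongrightarrow> xbar) (at_right 0)"
  proof (rule tendstoI)
    fix e :: real assume "0 < e"
    define \<delta> where "\<delta> = e / 6"
    have "0 < \<delta>" using \<open>0 < e\<close> by (simp add: \<delta>_def)
    have "eventually (\<lambda>r. dist (x r) xbar < \<delta>) at_top"
      using xbar(2) \<open>0 < \<delta>\<close> by (rule tendstoD)
    then obtain S where S: "\<And>r. r \<ge> S \<Longrightarrow> norm (x r - xbar) < \<delta>"
      by (auto simp: eventually_at_top_linorder dist_norm)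
    define t where "t = max S 0"
    have small: "eventually (\<lambda>\<epsilon>. c * \<epsilon> < \<delta>) (at_right 0)" for c :: real
    proof -
      have "((\<lambda>\<epsilon>. c * \<epsilon>) \<longlongrightarrow> c * 0) (at_right 0)"
        by (intro tendsto_intros)
      then show ?thesis using \<open>0 < \<delta>\<close> by (auto intro: order_tendstoD)
    qed
    have "eventually (\<lambda>\<epsilon>. \<epsilon> \<in> {0<..<\<eta>}) (at_right 0)"
      using \<eta>(1) by (rule eventually_at_right_real)
    moreover have "eventually (\<lambda>\<epsilon>. infdist xbar (Fix_on D (relax_comp \<epsilon> T m)) < \<delta>) (at_right 0)"
      using order_tendstoD(2)[OF dist_fix[OF fixed] \<open>0 < \<delta>\<close>] .
    moreover note small[of "4 * M * real m * (t + real m)"] small[of "real m * M"]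
    \<comment> \<open>The budget of six \<open>\<delta>\<close>: the sweep reached at time \<open>t\<close> is within \<open>2 \<delta>\<close> of \<open>xbar\<close>, hence
        within \<open>3 \<delta>\<close> of a fixed point \<open>z\<close> of \<open>R\<close>, as are all later ones; these are thus within \<open>4 \<delta>\<close>
        of \<open>xbar\<close>, and a partial sweep costs one more \<open>\<delta>\<close>. The sixth makes the final
        inequality strict.\<close>
    ultimately show "eventually (\<lambda>\<epsilon>. dist (xw \<epsilon> i) xbar < e) (at_right 0)"
    proof eventually_elim
      case (elim \<epsilon>)
      let ?R = "relax_comp \<epsilon> T m" and ?h = "real m * \<epsilon>"
      have \<epsilon>: "0 < \<epsilon>" "\<epsilon> \<le> 1" using elim(1) \<eta> by auto
      have h: "0 < ?h" "?h \<le> real m" using \<epsilon> m by auto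
      have R: "nonexpansive_self D ?R"
        by (rule nonexpansive_self_relax_comp) (use \<epsilon> D T in auto)
      have "Fix_on D ?R \<noteq> {}"
        using bounded_fix[OF elim(1)] by blast
      then obtain z where z: "z \<in> Fix_on D ?R" "norm (z - xbar) < \<delta>"
        using elim(2) cINF_less_iff[OF _ bdd_belowI2[of _ 0], of "Fix_on D ?R" "dist xbar" \<delta>]
        by (auto simp: infdist_notempty dist_norm norm_minus_commute)

      \<comment> \<open>The number of sweeps that first reaches time \<open>t\<close> on the scale of the flow.\<close>
      define k where "k = nat \<lceil>t / ?h\<rceil>"
      have "0 \<le> t / ?h" using h by (simp add: t_def)
      then have "t / ?h \<le> real k" "real k \<le> t / ?h + 1"
        unfolding k_def by linarith+
      then have k: "t \<le> real k * ?h" "real k * ?h \<le> t + ?h"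
        using h(1) m \<epsilon>(1) mult_right_mono[of "real k" "t / ?h + 1" ?h]
        by (simp_all add: pos_divide_le_eq distrib_right)
      have "norm ((?R ^^ k) y0 - x (real k * ?h)) \<le> 4 * M * ?h * (real k * ?h)"
        by (rule norm_sweeps_minus_flow_le)
          (use D \<epsilon> \<open>m \<ge> 1\<close> \<open>0 \<le> M\<close> T x disp_x in auto)
      also have "\<dots> \<le> 4 * M * ?h * (t + real m)"
        using k h \<open>0 \<le> M\<close> by (intro mult_left_mono) auto
      also have "\<dots> < \<delta>"
        using elim(3) by (simp add: mult_ac)
      finally have near_flow: "norm ((?R ^^ k) y0 - x (real k * ?h)) < \<delta>" .
      have "norm (x (real k * ?h) - xbar) < \<delta>"
        using k by (intro S) (simp add: t_def)
      then have near_z: "norm ((?R ^^ k) y0 - z) < 3 * \<delta>"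
        using near_flow z(2) dist_triangle[of "(?R ^^ k) y0" z "x (real k * ?h)"]
          dist_triangle[of "x (real k * ?h)" z xbar]
        by (simp add: dist_norm norm_minus_commute[of xbar])

      have "norm (y \<epsilon> (j * m + i) - xbar) \<le> 5 * \<delta>" if "k \<le> j" for j
      proof -
        let ?w = "(?R ^^ j) y0" and ?P = "relax_comp \<epsilon> T i"
        have P: "nonexpansive_self D ?P"
          by (rule nonexpansive_self_relax_comp) (use \<epsilon> D T i in auto)
        have "(?R ^^ l) y0 \<in> D" for l
          by (induction l) (use R y0 in \<open>auto intro: nonexpansive_self_in\<close>)
        then have "norm (?P ?w - ?P xbar) \<le> norm (?w - xbar)"
          using P xbar(1) by (auto intro: nonexpansive_self_norm_le)
        also have "\<dots> \<le> norm (?w - z) + norm (z - xbar)"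
          using norm_triangle_ineq[of "?w - z" "z - xbar"] by simp
        also have "\<dots> \<le> 4 * \<delta>"
          using norm_iterate_minus_fixed_point_antimono[OF R y0 z(1) that] near_z z(2) by linarith
        finally have "norm (?P ?w - ?P xbar) \<le> 4 * \<delta>" .
        moreover have "norm (?P xbar - xbar) \<le> real i * \<epsilon> * M"
        proof (rule norm_relax_comp_displacement_le)
          show "norm (T l xbar - xbar) \<le> M" if "l \<in> {1..i}" for l
            using disp_xbar[of l] that i C(1) by auto
        qed (use D \<epsilon> T xbar i in auto)
        moreover have "real i * \<epsilon> * M \<le> real m * M * \<epsilon>"
          using i \<epsilon> \<open>0 \<le> M\<close> by (simp add: mult_ac mult_right_mono mult_left_mono)
        ultimately have "norm (?P ?w - xbar) \<le> 5 * \<delta>"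
          using elim(4) norm_triangle_ineq[of "?P ?w - ?P xbar" "?P xbar - xbar"] by simp
        moreover have "y \<epsilon> (j * m + i) = ?P ?w"
          by (rule cyclic_iteration_eq_sweeps) (use y_init y_step elim(1) i in auto)
        ultimately show ?thesis by simp
      qed
      then have "norm (xw \<epsilon> i - xbar) \<le> 5 * \<delta>"
        by (intro norm_weak_limit_minus_le[OF xw[OF elim(1) i]])
          (auto simp: eventually_sequentially)
      then show ?case using \<open>0 < e\<close> by (simp add: dist_norm \<delta>_def)
    qed
  qed
qed

end
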